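(* For each Hessenberg function $h>(1,2,\ldots,n)$ there exists at least one Hessenberg function $h'$ adjacent to $h$ with both $h>h'$ and $\mathfrak{C}_h\subset\mathfrak{C}_{h'}$.
   Context: A Hessenberg function is an $n$-tuple $h=(h_1,\ldots,h_n)$ of integers with $i\le h_i\le n$ for all $i$ and $h_i\le h_{i+1}$ for $1\le i\le n-1$. Partial order: $h\le h'$ iff $h_i\le h'_i$ for all $i$; $h>h'$ means $h\ge h'$ and $h\neq h'$. Hessenberg functions $h>h'$ are adjacent if there is $i_0$ with $h'_{i_0}=h_{i_0}-1$ and $h'_i=h_i$ for all $i\ne i_0$. For $S\subseteq\{1,\ldots,n\}$, $e_d(S)$ is the sum of all squarefree monomials of degree $d$ in the variables $x_i$, $i\in S$ (with $e_0(S)=1$, $e_d(S)=0$ for $d<0$ or $d>|S|$), and $e_d(1,\ldots,m)$ means $S=\{1,\ldots,m\}$. $\mathfrak{C}_h$ is the set of polynomials $\{e_{h_i-r}(1,\ldots,h_i): 1\le i\le n,\ 0\le r\le i-1\}$ in $\mathbb{Z}[x_1,\ldots,x_n]$. *)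

theory Defs
  imports "HOL-Library.Poly_Mapping" "HOL-Library.FuncSet"
begin

text \<open>
  An \<open>n\<close>-tuple \<open>(h\<^sub>1, \<dots>, h\<^sub>n)\<close> is a function on \<open>{1..n}\<close> that is \<open>undefined\<close> elsewhere, so that
  equality of functions is equality of tuples. The entries are positive, hence of type \<open>nat\<close>.
\<close>

definition hessenberg :: "nat \<Rightarrow> (nat \<Rightarrow> nat) \<Rightarrow> bool" where
  "hessenberg n h \<longleftrightarrow>
     h \<in> extensional {1..n} \<and>
     (\<forall>i\<in>{1..n}. i \<le> h i \<and> h i \<le> n) \<and>
     (\<forall>i. 1 \<le> i \<and> i + 1 \<le> n \<longrightarrow> h i \<le> h (i + 1))"

definition hess_le :: "nat \<Rightarrow> (nat \<Rightarrow> nat) \<Rightarrow> (nat \<Rightarrow> nat) \<Rightarrow> bool" where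
  "hess_le n h h' \<longleftrightarrow> (\<forall>i\<in>{1..n}. h i \<le> h' i)"

definition hess_less :: "nat \<Rightarrow> (nat \<Rightarrow> nat) \<Rightarrow> (nat \<Rightarrow> nat) \<Rightarrow> bool" where
  "hess_less n h h' \<longleftrightarrow> hess_le n h h' \<and> h \<noteq> h'"

definition hess_adjacent :: "nat \<Rightarrow> (nat \<Rightarrow> nat) \<Rightarrow> (nat \<Rightarrow> nat) \<Rightarrow> bool" where
  "hess_adjacent n h h' \<longleftrightarrow>
     hessenberg n h \<and> hessenberg n h' \<and> hess_less n h' h \<and>
     (\<exists>i\<^sub>0\<in>{1..n}. int (h' i\<^sub>0) = int (h i\<^sub>0) - 1 \<and> (\<forall>i\<in>{1..n}. i \<noteq> i\<^sub>0 \<longrightarrow> h' i = h i))"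

text \<open>
  Integer polynomials in variables \<open>x\<^sub>i\<close> indexed by the natural numbers: finitely supported maps
  from exponent vectors to coefficients. The ring of polynomials in \<open>x\<^sub>1, \<dots>, x\<^sub>n\<close> is the subring of
  those whose monomials involve only these variables.
\<close>

type_synonym int_mpoly = "(nat \<Rightarrow>\<^sub>0 nat) \<Rightarrow>\<^sub>0 int"

definition var :: "nat \<Rightarrow> int_mpoly" where
  "var i = Poly_Mapping.single (Poly_Mapping.single i 1) 1"

definition esym :: "int \<Rightarrow> nat set \<Rightarrow> int_mpoly" where
  "esym d S = (\<Sum>X | X \<subseteq> S \<and> int (card X) = d. \<Prod>i\<in>X. var i)"

lemma esym_0:
  assumes "finite S"
  shows "esym 0 S = 1"
proof -
  have "X = {}" if "X \<subseteq> S" "int (card X) = 0" for X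
    using that finite_subset[OF that(1) assms] by simp
  then have "{X. X \<subseteq> S \<and> int (card X) = 0} = {{}}"
    by (intro equalityI subsetI; simp)
  then show ?thesis unfolding esym_def by (simp only:) simp
qed

lemma esym_eq_0:
  assumes "finite S" and "d < 0 \<or> d > int (card S)"
  shows "esym d S = 0"
proof -
  have "int (card X) \<noteq> d" if "X \<subseteq> S" for X
    using card_mono[OF assms(1) that] assms(2) by linarith
  then have "{X. X \<subseteq> S \<and> int (card X) = d} = {}"
    by blast
  then show ?thesis unfolding esym_def by (simp only: sum.empty)
qed

definition C_set :: "nat \<Rightarrow> (nat \<Rightarrow> nat) \<Rightarrow> int_mpoly set" where
  "C_set n h =
     {esym (int (h i) - int r) {1..h i} | i r. 1 \<le> i \<and> i \<le> n \<and> r \<le> i - 1}"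

end

theory Submission
  imports Defs
begin

text \<open>
  Let \<open>i\<close> be the last index with \<open>h\<^sub>i > i\<close>; maximality forces \<open>h\<^sub>i = h\<^sub>i\<^sub>+\<^sub>1 = i + 1\<close>. Lower \<open>h\<close> by one at
  the first index \<open>p\<close> where it takes the value \<open>v = i + 1\<close>. No polynomial is lost, since those
  contributed by \<open>p\<close> are also contributed by \<open>p + 1\<close>. The polynomial \<open>e\<^sub>v\<^sub>-\<^sub>p(1, \<dots>, v - 1)\<close> is gained:
  non-constant elementary symmetric polynomials determine both their degree and their set
  of variables, so it could only have come from an index \<open>j \<ge> p\<close> with \<open>h\<^sub>j = v - 1\<close>.
\<close>

definition squarefree_exponent :: "nat set \<Rightarrow> nat \<Rightarrow>\<^sub>0 nat" where
  "squarefree_exponent X = (\<Sum>i\<in>X. Poly_Mapping.single i 1)"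

lemma lookup_squarefree_exponent:
  assumes "finite X"
  shows "Poly_Mapping.lookup (squarefree_exponent X) i = (if i \<in> X then 1 else 0)"
  using assms
  by (simp add: squarefree_exponent_def lookup_sum lookup_single when_def)

lemma squarefree_exponent_inject:
  assumes "finite X" "finite Y"
  shows "squarefree_exponent X = squarefree_exponent Y \<longleftrightarrow> X = Y"
proof
  assume eq: "squarefree_exponent X = squarefree_exponent Y"
  have "i \<in> X \<longleftrightarrow> i \<in> Y" for i
    using arg_cong[OF eq, of "\<lambda>m. Poly_Mapping.lookup m i"] assms
    by (simp add: lookup_squarefree_exponent split: if_splits)
  then show "X = Y" by blast
qed simp

lemma prod_var_eq_single:
  assumes "finite X"
  shows "(\<Prod>i\<in>X. var i) = Poly_Mapping.single (squarefree_exponent X) 1"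
  using assms
proof (induction X)
  case empty
  show ?case by (simp add: squarefree_exponent_def)
next
  case (insert x X)
  then show ?case by (simp add: squarefree_exponent_def var_def mult_single)
qed

text \<open>Distinct subsets give distinct monomials, so no terms of \<open>esym d S\<close> merge
  and its coefficients record exactly which subsets occur.\<close>

lemma lookup_esym_squarefree_exponent:
  assumes "finite S" "finite Y"
  shows "Poly_Mapping.lookup (esym d S) (squarefree_exponent Y)
    = (if Y \<subseteq> S \<and> int (card Y) = d then 1 else 0)"
proof -
  let ?A = "{X. X \<subseteq> S \<and> int (card X) = d}"
  have fin: "finite ?A"
    using assms(1) by simp
  have "Poly_Mapping.lookup (esym d S) (squarefree_exponent Y)
      = (\<Sum>X\<in>?A. Poly_Mapping.lookup (\<Prod>i\<in>X. var i) (squarefree_exponent Y))"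
    by (simp add: esym_def lookup_sum)
  also have "\<dots> = (\<Sum>X\<in>?A. if X = Y then 1 else 0)"
  proof (rule sum.cong)
    fix X assume "X \<in> ?A"
    then have "finite X" using assms(1) finite_subset by blast
    then show "Poly_Mapping.lookup (\<Prod>i\<in>X. var i) (squarefree_exponent Y)
        = (if X = Y then 1 else 0)"
      using assms(2)
      by (simp add: prod_var_eq_single lookup_single when_def squarefree_exponent_inject)
  qed simp
  also have "\<dots> = (if Y \<subseteq> S \<and> int (card Y) = d then 1 else 0)"
    using fin by simp
  finally show ?thesis .
qed

text \<open>Compare coefficients at the monomials of the \<open>d\<close>-subsets of
  \<open>S\<close>: each of these must be a \<open>d'\<close>-subset of \<open>T\<close>. As
  \<open>1 \<le> d \<le> card S\<close>, such subsets exist and cover \<open>S\<close>. Applying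
  this in both directions yields \<open>S = T\<close>.\<close>

lemma esym_eq_imp:
  assumes eq: "esym d S = esym d' T" and fin: "finite S" "finite T"
    and d: "1 \<le> d" "d \<le> int (card S)"
  shows "d = d' \<and> S \<subseteq> T"
proof -
  have *: "Y \<subseteq> T \<and> d = d'" if "Y \<subseteq> S" "int (card Y) = d" for Y
  proof -
    have "finite Y" using that(1) fin(1) finite_subset by blast
    then show ?thesis
      using arg_cong[OF eq, of "\<lambda>p. Poly_Mapping.lookup p (squarefree_exponent Y)"] that fin
      by (simp add: lookup_esym_squarefree_exponent split: if_splits)
  qed
  have ex: "\<exists>Y. s \<in> Y \<and> Y \<subseteq> S \<and> int (card Y) = d" if "s \<in> S" for s
  proof -
    \<comment> \<open>Complete \<open>s\<close> to a \<open>d\<close>-subset by \<open>d - 1\<close>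
      other elements of \<open>S\<close>.\<close>
    have "nat d - 1 \<le> card (S - {s})"
      using that fin(1) d by simp
    then obtain Z where Z: "Z \<subseteq> S - {s}" "card Z = nat d - 1" "finite Z"
      by (rule obtain_subset_with_card_n)
    then have "s \<notin> Z" by blast
    then have "int (card (insert s Z)) = d"
      using Z d by simp
    then show ?thesis using Z that by (intro exI[of _ "insert s Z"]) blast
  qed
  have "S \<noteq> {}" using d by auto
  then show ?thesis using * ex by (meson ex_in_conv subset_iff)
qed

lemma hessenberg_mono:
  assumes "hessenberg n h" "1 \<le> i" "i \<le> j" "j \<le> n"
  shows "h i \<le> h j"
  using assms(3,4)
proof (induction j rule: dec_induct)
  case (step j)
  then have "h j \<le> h (j + 1)"
    using assms(1,2) unfolding hessenberg_def by simp
  then show ?case using step by simp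
qed simp

text \<open>Lowering \<open>h\<close> at \<open>p\<close> stays above the diagonal because
  \<open>p < h p\<close> and stays monotone because all earlier values are strictly smaller;
  \<open>h (p + 1) = h p\<close> lets \<open>p + 1\<close> replace \<open>p\<close> as a source of
  polynomials.\<close>

lemma hessenberg_descent_index:
  assumes h: "hessenberg n h" and "hess_less n (restrict (\<lambda>i. i) {1..n}) h"
  obtains p where "1 \<le> p" "p + 1 \<le> n" "p < h p" "h (p + 1) = h p"
    "\<And>j. 1 \<le> j \<Longrightarrow> j < p \<Longrightarrow> h j < h p"
proof -
  have bounds: "i \<le> h i \<and> h i \<le> n" if "1 \<le> i" "i \<le> n" for i
    using h that by (simp add: hessenberg_def)
  let ?P = "\<lambda>i. 1 \<le> i \<and> i \<le> n \<and> i < h i"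
  have "\<exists>i. ?P i"
  proof (rule ccontr)
    assume no: "\<nexists>i. ?P i"
    have "restrict (\<lambda>i. i) {1..n} = h"
    proof (rule extensionalityI[where A = "{1..n}"])
      show "h \<in> extensional {1..n}" using h by (simp add: hessenberg_def)
    next
      fix i assume "i \<in> {1..n}"
      then show "restrict (\<lambda>i. i) {1..n} i = h i"
        using no bounds[of i] by (auto simp: le_less)
    qed simp
    then show False using assms(2) by (simp add: hess_less_def)
  qed
  then obtain i where i: "?P i" and max: "\<And>j. ?P j \<Longrightarrow> j \<le> i"
    using Nat.ex_has_greatest_nat[of ?P _ n] by blast
  have "i < n" using i bounds[of i] by linarith
  then have "h (i + 1) = i + 1"
    using max[of "i + 1"] bounds[of "i + 1"] by force
  moreover have "h i \<le> h (i + 1)"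
    using hessenberg_mono[OF h, of i "i + 1"] i \<open>i < n\<close> by simp
  ultimately have hi: "h i = i + 1" "h (i + 1) = i + 1" using i by simp_all
  let ?Q = "\<lambda>j. 1 \<le> j \<and> h j = i + 1"
  define p where "p = (LEAST j. ?Q j)"
  have "?Q i" using hi i by simp
  then have p: "?Q p" and pi: "p \<le> i"
    unfolding p_def by (rule LeastI, rule Least_le)
  \<comment> \<open>Since \<open>p \<le> i\<close>, the value at \<open>p + 1\<close> is squeezed
    between \<open>h p\<close> and \<open>h (i + 1)\<close>, both equal to
    \<open>i + 1\<close>.\<close>
  have "h p \<le> h (p + 1)" "h (p + 1) \<le> h (i + 1)"
    using hessenberg_mono[OF h, of p "p + 1"] hessenberg_mono[OF h, of "p + 1" "i + 1"]
      p pi \<open>i < n\<close> by simp_all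
  then have "h (p + 1) = h p" using p hi by simp
  moreover have "h j < h p" if "1 \<le> j" "j < p" for j
  proof -
    have "h j \<noteq> i + 1" using not_less_Least[of j ?Q] that unfolding p_def by blast
    moreover have "h j \<le> h p"
      using hessenberg_mono[OF h, of j p] that pi \<open>i < n\<close> by simp
    ultimately show ?thesis using p by simp
  qed
  ultimately show thesis using p pi \<open>i < n\<close> by (intro that[of p]) auto
qed

theorem theorem4p12:
  fixes n :: nat and h :: "nat \<Rightarrow> nat"
  assumes "hessenberg n h"
    and "hess_less n (restrict (\<lambda>i. i) {1..n}) h"
  shows "\<exists>h'. hessenberg n h' \<and> hess_adjacent n h h' \<and> hess_less n h' h \<and> C_set n h \<subset> C_set n h'"
proof -
  obtain p where p: "1 \<le> p" "p + 1 \<le> n" "p < h p" "h (p + 1) = h p"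
    and before: "\<And>j. 1 \<le> j \<Longrightarrow> j < p \<Longrightarrow> h j < h p"
    using hessenberg_descent_index[OF assms] by blast
  have bounds: "i \<le> h i \<and> h i \<le> n" if "1 \<le> i" "i \<le> n" for i
    using assms(1) that by (simp add: hessenberg_def)
  define h' where "h' = h(p := h p - 1)"
  have h'_p: "h' p = h p - 1" and h'_other: "\<And>i. i \<noteq> p \<Longrightarrow> h' i = h i"
    by (simp_all add: h'_def)
  have hess: "hessenberg n h'"
    unfolding hessenberg_def
  proof (intro conjI ballI allI impI)
    have "h \<in> extensional {1..n}" using assms(1) by (simp add: hessenberg_def)
    then show "h' \<in> extensional {1..n}" using p by (auto simp: h'_def extensional_def)
  next
    fix i assume "i \<in> {1..n}"
    then show "i \<le> h' i" "h' i \<le> n"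
      using bounds[of i] p by (auto simp: h'_def)
  next
    fix i assume i: "1 \<le> i \<and> i + 1 \<le> n"
    then have "h i \<le> h (i + 1)"
      using hessenberg_mono[OF assms(1), of i "i + 1"] by simp
    \<comment> \<open>The critical case is \<open>i + 1 = p\<close>, where strictness before
      \<open>p\<close> absorbs the decrease by one.\<close>
    then show "h' i \<le> h' (i + 1)"
      using before[of i] i by (auto simp: h'_def)
  qed
  have less: "hess_less n h' h"
  proof -
    have "h' p \<noteq> h p" using p h'_p by simp
    then have "h' \<noteq> h" by auto
    moreover have "hess_le n h' h" by (simp add: hess_le_def h'_def)
    ultimately show ?thesis by (simp add: hess_less_def)
  qed
  have adj: "hess_adjacent n h h'"
    unfolding hess_adjacent_def
    using assms(1) hess less p h'_p h'_other by (auto intro!: bexI[of _ p])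
  have "C_set n h \<subseteq> C_set n h'"
  proof
    fix q assume "q \<in> C_set n h"
    then obtain i r where q: "q = esym (int (h i) - int r) {1..h i}" "1 \<le> i" "i \<le> n" "r \<le> i - 1"
      unfolding C_set_def by blast
    \<comment> \<open>The index \<open>p + 1\<close> keeps the old value \<open>h p\<close> and
      still admits every \<open>r \<le> p - 1\<close>.\<close>
    define k where "k = (if i = p then p + 1 else i)"
    have "q = esym (int (h' k) - int r) {1..h' k}" "1 \<le> k" "k \<le> n" "r \<le> k - 1"
      using q p h'_other by (auto simp: k_def)
    then show "q \<in> C_set n h'" unfolding C_set_def by blast
  qed
  moreover
  \<comment> \<open>The largest \<open>r\<close> available at \<open>p\<close> gives the lowest
    degree, \<open>h p - p \<ge> 1\<close>; an index below \<open>p\<close> cannot supply so large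
    an \<open>r\<close>.\<close>
  let ?q = "esym (int (h' p) - int (p - 1)) {1..h' p}"
  have "?q \<in> C_set n h'"
  proof -
    have "1 \<le> p" "p \<le> n" "p - 1 \<le> p - 1" using p by simp_all
    then show ?thesis unfolding C_set_def by blast
  qed
  moreover have "?q \<notin> C_set n h"
  proof
    assume "?q \<in> C_set n h"
    then obtain j r where eq: "?q = esym (int (h j) - int r) {1..h j}"
      and j: "1 \<le> j" "j \<le> n" "r \<le> j - 1"
      unfolding C_set_def by blast
    have d: "int (h' p) - int (p - 1) = int (h j) - int r" and "{1..h' p} \<subseteq> {1..h j}"
      using esym_eq_imp[OF eq] p h'_p by simp_all
    \<comment> \<open>\<open>r < j \<le> h j\<close> makes the degree positive, so the comparison
      also applies in the reverse direction.\<close>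
    moreover have "1 \<le> int (h j) - int r" using j bounds[of j] by linarith
    then have "{1..h j} \<subseteq> {1..h' p}"
      using esym_eq_imp[OF eq[symmetric]] by simp
    ultimately have hj: "h j = h' p"
      by (metis card_atLeastAtMost diff_Suc_1 subset_antisym)
    \<comment> \<open>Equal degrees and \<open>h j = h' p\<close> force \<open>r = p - 1\<close>,
      while \<open>r \<le> j - 1\<close>. Monotonicity then gives
      \<open>h p \<le> h j = h p - 1\<close>, which is absurd.\<close>
    then have "p \<le> j" using d j p by linarith
    then have "h p \<le> h j" using hessenberg_mono[OF assms(1)] j p by blast
    then show False using hj h'_p p by simp
  qed
  ultimately have "C_set n h \<subset> C_set n h'" by blast
  then show ?thesis using hess adj less by blast
qed

end
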